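(* Let $n\ge 1$ and let $G$ be a graph with $n+1$ vertices and $1+\binom{n}{2}$ edges. If $C$ is a cute $n$-edge-colouring of $G$, then $G$ has a heterochromatic spanning tree.
   Context: An $n$-edge-colouring of $G$ is a partition of $E(G)$ into $n$ colour classes. It is called cute if the sizes of the $n$ colour classes are $1,1,2,3,\ldots,n-1$ (i.e. one class of size $1$ together with one class of each size $1,2,\ldots,n-1$). A subgraph is heterochromatic if all its edges have different colours. *)

theory Defs
  imports Main "HOL-Library.Multiset" "HOL-Library.Disjoint_Sets"
begin

text \<open>A finite simple graph is given by its vertex set \<open>V\<close> and its edge set \<open>E\<close>,
  each edge being the two-element set of its end vertices.\<close>

definition simple_graph :: "'a set \<Rightarrow> 'a set set \<Rightarrow> bool" where
  "simple_graph V E \<longleftrightarrow> finite V \<and> (\<forall>e\<in>E. e \<subseteq> V \<and> card e = 2)"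

definition walk :: "'a set \<Rightarrow> 'a set set \<Rightarrow> 'a list \<Rightarrow> bool" where
  "walk V E p \<longleftrightarrow> p \<noteq> [] \<and> set p \<subseteq> V \<and> successively (\<lambda>u v. {u, v} \<in> E) p"

definition connected_graph :: "'a set \<Rightarrow> 'a set set \<Rightarrow> bool" where
  "connected_graph V E \<longleftrightarrow>
     V \<noteq> {} \<and> (\<forall>u\<in>V. \<forall>v\<in>V. \<exists>p. walk V E p \<and> hd p = u \<and> last p = v)"

text \<open>A cycle is listed without repeating its first vertex at the end.\<close>

definition cycle :: "'a set \<Rightarrow> 'a set set \<Rightarrow> 'a list \<Rightarrow> bool" where
  "cycle V E p \<longleftrightarrow> walk V E p \<and> distinct p \<and> length p \<ge> 3 \<and> {last p, hd p} \<in> E"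

definition tree :: "'a set \<Rightarrow> 'a set set \<Rightarrow> bool" where
  "tree V E \<longleftrightarrow> simple_graph V E \<and> connected_graph V E \<and> (\<nexists>p. cycle V E p)"

text \<open>A spanning tree of \<open>(V, E)\<close> has all of \<open>V\<close> as its vertex set, so it is
  identified with its edge set \<open>T\<close>.\<close>

definition spanning_tree :: "'a set \<Rightarrow> 'a set set \<Rightarrow> 'a set set \<Rightarrow> bool" where
  "spanning_tree V E T \<longleftrightarrow> T \<subseteq> E \<and> tree V T"

text \<open>A colouring is the set \<open>C\<close> of its colour classes; \<^const>\<open>partition_on\<close> requires
  these to be nonempty.\<close>

definition edge_colouring :: "nat \<Rightarrow> 'a set set \<Rightarrow> 'a set set set \<Rightarrow> bool" where
  "edge_colouring n E C \<longleftrightarrow> partition_on E C \<and> card C = n"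

text \<open>The multiset of class sizes is \<open>1, 1, 2, \<dots>, n - 1\<close>, which for \<open>n = 1\<close> is just \<open>1\<close>.\<close>

definition cute_edge_colouring :: "nat \<Rightarrow> 'a set set \<Rightarrow> 'a set set set \<Rightarrow> bool" where
  "cute_edge_colouring n E C \<longleftrightarrow>
     edge_colouring n E C \<and> image_mset card (mset_set C) = add_mset 1 (mset_set {1..<n})"

definition heterochromatic :: "'a set set set \<Rightarrow> 'a set set \<Rightarrow> bool" where
  "heterochromatic C F \<longleftrightarrow>
     (\<forall>e\<in>F. \<forall>f\<in>F. e \<noteq> f \<longrightarrow> \<not> (\<exists>K\<in>C. e \<in> K \<and> f \<in> K))"

end

theory Submission
  imports Defs
begin

text \<open>By Rado's theorem for the graphic matroid, a heterochromatic spanning tree exists as soon as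
  the union of any \<open>r\<close> colour classes has rank at least \<open>r\<close>. For \<open>r \<ge> 1\<close> such a union has at least
  \<open>1 + (1 + 2 + \<dots> + (r - 1)) = 1 + (r choose 2)\<close> edges, whereas a graph of rank at most \<open>r - 1\<close>
  has at most \<open>r choose 2\<close> edges, the extremal case being a complete graph on \<open>r\<close> vertices.\<close>

section \<open>Rado's theorem for a submodular function\<close>

text \<open>Insert the elements of \<open>Y\<close> one at a time into both \<open>X\<close> and
  \<open>X \<inter> Y\<close>. By \<open>dim\<close> each insertion gains at most as much for the
  larger set, and at the end the two sets have become \<open>X \<union> Y\<close> and
  \<open>Y\<close>.\<close>

lemma submodular_if_diminishing_returns:
  fixes f :: "'b set \<Rightarrow> nat"
  assumes dim: "\<And>e X Y. \<lbrakk>X \<subseteq> Y; Y \<subseteq> E; e \<in> E\<rbrakk> \<Longrightarrow> f (insert e Y) + f X \<le> f (insert e X) + f Y"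
    and "finite E" "X \<subseteq> E" "Y \<subseteq> E"
  shows "f (X \<union> Y) + f (X \<inter> Y) \<le> f X + f Y"
proof -
  have "f (X \<union> Z) + f (X \<inter> Y) \<le> f (X \<inter> Y \<union> Z) + f X" if "finite Z" "Z \<subseteq> E" for Z
    using that
  proof (induction Z)
    case (insert e Z)
    have "f (insert e (X \<union> Z)) + f (X \<inter> Y \<union> Z) \<le> f (insert e (X \<inter> Y \<union> Z)) + f (X \<union> Z)"
      using insert.prems assms(3) by (intro dim) auto
    with insert show ?case by simp
  qed simp
  from this[of Y] show ?thesis
    using assms by (simp add: finite_subset Un_absorb1)
qed

text \<open>Rado's shrinking argument: elements are deleted from the sets \<open>A i\<close> as long
  as the Hall-type condition survives, by induction on the total size. Once all sets are singletons,
  the condition for \<open>J = I\<close> is the claim. Independence of the transversal is expressed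
  by its rank being at least \<open>card I\<close>; if \<open>f\<close> is bounded by cardinality,
  this forces \<open>t\<close> to be injective on \<open>I\<close>.\<close>

theorem rado_submodular:
  fixes f :: "'b set \<Rightarrow> nat" and A :: "'i \<Rightarrow> 'b set"
  assumes "finite E" "finite I" "f {} = 0"
    and mono: "\<And>X Y. \<lbrakk>X \<subseteq> Y; Y \<subseteq> E\<rbrakk> \<Longrightarrow> f X \<le> f Y"
    and submod: "\<And>X Y. \<lbrakk>X \<subseteq> E; Y \<subseteq> E\<rbrakk> \<Longrightarrow> f (X \<union> Y) + f (X \<inter> Y) \<le> f X + f Y"
    and "\<And>i. i \<in> I \<Longrightarrow> A i \<subseteq> E"
    and "\<And>J. J \<subseteq> I \<Longrightarrow> card J \<le> f (\<Union>(A ` J))"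
  shows "\<exists>t. (\<forall>i\<in>I. t i \<in> A i) \<and> card I \<le> f (t ` I)"
  using assms(6,7)
proof (induction "\<Sum>i\<in>I. card (A i)" arbitrary: A rule: less_induct)
  case less
  have fin: "finite (A i)" if "i \<in> I" for i
    using less.prems(1)[OF that] \<open>finite E\<close> by (rule finite_subset)
  have ne: "A i \<noteq> {}" if "i \<in> I" for i
    using less.prems(2)[of "{i}"] that \<open>f {} = 0\<close> by auto
  show ?case
  proof (cases "\<exists>i\<in>I. \<exists>x\<in>A i. \<exists>y\<in>A i. x \<noteq> y")
    case False
    define t where "t i = (SOME x. x \<in> A i)" for i
    have t: "t i \<in> A i" if "i \<in> I" for i
      using ne[OF that] by (simp add: t_def some_in_eq)
    have "A i = {t i}" if "i \<in> I" for i
      using False t that by blast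
    then have "\<Union>(A ` I) = t ` I" by auto
    with less.prems(2)[of I] t show ?thesis by auto
  next
    case True
    then obtain i x y where i: "i \<in> I" and xy: "x \<in> A i" "y \<in> A i" "x \<noteq> y" by blast
    \<comment> \<open>If deleting \<open>z\<close> breaks the condition for some family, that family
      contains \<open>i\<close>, since all other sets are unchanged. Dropping \<open>i\<close> from
      it yields \<open>J\<close>, which turns the strict inequality into
      \<open>\<le>\<close>.\<close>
    have shrink: "(\<exists>t. (\<forall>j\<in>I. t j \<in> A j) \<and> card I \<le> f (t ` I)) \<or>
        (\<exists>J \<subseteq> I - {i}. f (\<Union>(A ` J) \<union> (A i - {z})) \<le> card J)" if z: "z \<in> A i" for z
    proof -
      define B where "B = A(i := A i - {z})"
      have B: "B i = A i - {z}" "\<And>j. j \<noteq> i \<Longrightarrow> B j = A j" "\<And>j. B j \<subseteq> A j"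
        by (auto simp: B_def)
      show ?thesis
      proof (cases "\<forall>J \<subseteq> I. card J \<le> f (\<Union>(B ` J))")
        case True
        have "card (B i) < card (A i)"
          using fin[OF i] z unfolding B(1) by (rule card_Diff1_less)
        then have "(\<Sum>j\<in>I. card (B j)) < (\<Sum>j\<in>I. card (A j))"
          using \<open>finite I\<close> i fin B(3) by (intro sum_strict_mono_ex1) (auto intro!: card_mono)
        moreover have "B j \<subseteq> E" if "j \<in> I" for j
          using less.prems(1)[OF that] B(3) by blast
        moreover have "card J \<le> f (\<Union>(B ` J))" if "J \<subseteq> I" for J
          using True that by blast
        ultimately obtain t where "\<forall>j\<in>I. t j \<in> B j" "card I \<le> f (t ` I)"
          using less.hyps[of B] by blast
        with B(3) show ?thesis by blast
      next
        case False
        then obtain J where J: "J \<subseteq> I" "f (\<Union>(B ` J)) < card J"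
          by (auto simp: not_le)
        have "i \<in> J"
        proof (rule ccontr)
          assume "i \<notin> J"
          then have "B ` J = A ` J" using B(2) by (intro image_cong refl) metis
          with J less.prems(2)[of J] show False by simp
        qed
        moreover have "B ` (J - {i}) = A ` (J - {i})"
          using B(2) by (intro image_cong refl) blast
        ultimately have "\<Union>(B ` J) = \<Union>(A ` (J - {i})) \<union> (A i - {z})"
          using B(1) by (metis Un_commute Union_insert image_insert insert_Diff)
        moreover have "card J = Suc (card (J - {i}))"
          using \<open>i \<in> J\<close> J(1) \<open>finite I\<close> by (metis card.remove finite_subset)
        ultimately have "f (\<Union>(A ` (J - {i})) \<union> (A i - {z})) \<le> card (J - {i})"
          using J(2) by simp
        with J(1) show ?thesis by blast
      qed
    qed
    show ?thesis
    proof (rule ccontr)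
      assume no: "\<not> ?thesis"
      obtain J where J: "J \<subseteq> I - {i}" "f (\<Union>(A ` J) \<union> (A i - {x})) \<le> card J"
        using shrink[OF xy(1)] no by blast
      obtain K where K: "K \<subseteq> I - {i}" "f (\<Union>(A ` K) \<union> (A i - {y})) \<le> card K"
        using shrink[OF xy(2)] no by blast
      \<comment> \<open>Both deletions are blocked. As \<open>x\<close> and \<open>y\<close> differ,
        \<open>X \<union> Y\<close> contains all of \<open>A i\<close> and is thus the union over
        \<open>insert i (J \<union> K)\<close>, while \<open>X \<inter> Y\<close> contains the union
        over \<open>J \<inter> K\<close>. The condition for these two families exceeds the
        submodular bound \<open>card J + card K\<close> by one.\<close>
      define X where "X = \<Union>(A ` J) \<union> (A i - {x})"
      define Y where "Y = \<Union>(A ` K) \<union> (A i - {y})"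
      have sub: "X \<subseteq> E" "Y \<subseteq> E"
        using J(1) K(1) i less.prems(1) unfolding X_def Y_def by blast+
      have finJK: "finite J" "finite K"
        using J(1) K(1) \<open>finite I\<close> by (meson finite_Diff finite_subset)+
      have XY: "X \<union> Y = \<Union>(A ` insert i (J \<union> K))"
        using xy unfolding X_def Y_def by auto
      have "card (insert i (J \<union> K)) \<le> f (X \<union> Y)"
        unfolding XY using i J(1) K(1) by (intro less.prems(2)) blast
      moreover have "card (insert i (J \<union> K)) = Suc (card (J \<union> K))"
        using finJK J(1) K(1) by (intro card_insert_disjoint) auto
      moreover have "card (J \<inter> K) \<le> f (X \<inter> Y)"
      proof -
        have "card (J \<inter> K) \<le> f (\<Union>(A ` (J \<inter> K)))"
          using J(1) by (intro less.prems(2)) auto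
        also have "\<dots> \<le> f (X \<inter> Y)"
          using sub by (intro mono) (auto simp: X_def Y_def)
        finally show ?thesis .
      qed
      moreover have "card J + card K = card (J \<union> K) + card (J \<inter> K)"
        using finJK by (rule card_Un_Int)
      ultimately show False
        using submod[OF sub] J(2) K(2) unfolding X_def Y_def by linarith
    qed
  qed
qed

section \<open>The rank of a graph\<close>

text \<open>Reflexivity makes an isolated vertex a component of its own, so for a graph with vertex
  set \<open>V\<close> the quotient \<open>V // reach F\<close> is the set of its
  components.\<close>

definition reach :: "'a set set \<Rightarrow> ('a \<times> 'a) set" where
  "reach F = {(u, v). {u, v} \<in> F}\<^sup>*"

text \<open>The rank of \<open>F\<close> in the graphic matroid, as vertices minus components. For
  finite \<open>V\<close> the subtraction does not truncate, by
  \<open>card_quotient_reach_le\<close>.\<close>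

definition grank :: "'a set \<Rightarrow> 'a set set \<Rightarrow> nat" where
  "grank V F = card V - card (V // reach F)"

lemma reach_refl [simp]: "(u, u) \<in> reach F"
  by (simp add: reach_def)

lemma reach_sym: "(u, v) \<in> reach F \<Longrightarrow> (v, u) \<in> reach F"
proof -
  have "sym {(u, v). {u, v} \<in> F}" by (simp add: sym_def insert_commute)
  then have "sym (reach F)" unfolding reach_def by (rule sym_rtrancl)
  then show "(u, v) \<in> reach F \<Longrightarrow> (v, u) \<in> reach F" by (rule symD)
qed

lemma reach_trans: "(u, v) \<in> reach F \<Longrightarrow> (v, w) \<in> reach F \<Longrightarrow> (u, w) \<in> reach F"
  by (simp add: reach_def)

lemma reach_edge: "{u, v} \<in> F \<Longrightarrow> (u, v) \<in> reach F"
  by (auto simp: reach_def)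

lemma reach_mono: "F \<subseteq> F' \<Longrightarrow> reach F \<subseteq> reach F'"
  unfolding reach_def by (intro rtrancl_mono) auto

lemma reach_image_eq: "(u, v) \<in> reach F \<Longrightarrow> reach F `` {u} = reach F `` {v}"
  using reach_sym reach_trans by fast

lemma reach_isolated:
  assumes "(u, v) \<in> reach F" "\<And>e. e \<in> F \<Longrightarrow> u \<notin> e"
  shows "u = v"
proof (rule ccontr)
  assume "u \<noteq> v"
  with assms(1) obtain w where "{u, w} \<in> F"
    unfolding reach_def by (auto elim: converse_rtranclE)
  with assms(2) show False by blast
qed

lemma reach_insert:
  "(x, y) \<in> reach (insert {u, v} F) \<longleftrightarrow> (x, y) \<in> reach F \<or>
     ((x, u) \<in> reach F \<or> (x, v) \<in> reach F) \<and> ((u, y) \<in> reach F \<or> (v, y) \<in> reach F)"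
proof -
  \<comment> \<open>An undirected edge enters the relation as two ordered pairs, so
    \<open>rtrancl_insert\<close> is used once for each; symmetry and transitivity of
    \<open>reach F\<close> then collapse the resulting cases.\<close>
  have *: "{(x, y). {x, y} \<in> insert {u, v} F} = insert (u, v) (insert (v, u) {(x, y). {x, y} \<in> F})"
    by (auto simp: doubleton_eq_iff)
  have "{(x, y). {x, y} \<in> F}\<^sup>* = reach F" by (simp add: reach_def)
  then have "reach (insert {u, v} F) = reach F \<union> {(x, y). (x, v) \<in> reach F \<and> (u, y) \<in> reach F}
     \<union> {(x, y). ((x, u) \<in> reach F \<or> (x, v) \<in> reach F \<and> (u, u) \<in> reach F)
       \<and> ((v, y) \<in> reach F \<or> (v, v) \<in> reach F \<and> (u, y) \<in> reach F)}"
    unfolding reach_def[of "insert _ _"] * rtrancl_insert by auto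
  then show ?thesis
    using reach_trans reach_sym by auto
qed

lemma card_quotient_reach_le: "finite V \<Longrightarrow> card (V // reach F) \<le> card V"
  by (simp add: quotient_def UNION_singleton_eq_range card_image_le)

text \<open>The distinct components of \<open>u\<close> and \<open>v\<close> are replaced by their
  union and all other components survive, so exactly one is lost.\<close>

lemma card_quotient_reach_insert:
  assumes "finite V" "u \<in> V" "v \<in> V" "(u, v) \<notin> reach F"
  shows "card (V // reach F) = Suc (card (V // reach (insert {u, v} F)))"
proof -
  let ?R = "reach F" and ?R' = "reach (insert {u, v} F)"
  let ?U = "?R `` {u}" and ?W = "?R `` {v}"
  have UW: "?R' `` {x} = (if x \<in> ?U \<union> ?W then ?U \<union> ?W else ?R `` {x})" for x
  proof -
    have sym: "x \<in> ?U \<union> ?W \<longleftrightarrow> (x, u) \<in> ?R \<or> (x, v) \<in> ?R"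
      using reach_sym by fast
    have "?R' `` {x} = ?R `` {x} \<union> {y. ((x, u) \<in> ?R \<or> (x, v) \<in> ?R) \<and> y \<in> ?U \<union> ?W}"
      by (auto simp: reach_insert)
    moreover have "?R `` {x} \<subseteq> ?U \<union> ?W" if "(x, u) \<in> ?R \<or> (x, v) \<in> ?R"
      using that reach_image_eq by fast
    ultimately show ?thesis unfolding sym by auto
  qed
  have cls: "x \<in> ?U \<union> ?W \<longleftrightarrow> ?R `` {x} \<in> {?U, ?W}" for x
    using reach_image_eq[of u x F] reach_image_eq[of v x F] reach_refl[of x F]
    by (auto simp del: reach_refl)
  have eq: "V // ?R' = insert (?U \<union> ?W) (V // ?R - {?U, ?W})"
  proof (intro equalityI subsetI)
    fix c assume "c \<in> V // ?R'"
    then obtain x where "x \<in> V" "c = ?R' `` {x}" by (rule quotientE)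
    then show "c \<in> insert (?U \<union> ?W) (V // ?R - {?U, ?W})"
      using cls[of x] UW[of x] by (auto intro: quotientI)
  next
    fix c assume "c \<in> insert (?U \<union> ?W) (V // ?R - {?U, ?W})"
    then consider "c = ?R' `` {u}" | x where "x \<in> V" "c = ?R `` {x}" "?R `` {x} \<notin> {?U, ?W}"
      using UW[of u] by (metis (no_types, lifting) DiffD1 DiffD2 Image_singleton_iff UnI1 insertE
        quotientE reach_refl)
    then show "c \<in> V // ?R'"
    proof cases
      case 1
      then show ?thesis using assms by (simp add: quotientI)
    next
      case (2 x)
      then show ?thesis using UW[of x] cls[of x] quotientI[of x V ?R'] by simp
    qed
  qed
  \<comment> \<open>The merged class is new: an old class containing \<open>u\<close> is
    \<open>?U\<close> itself, which has been removed.\<close>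
  have "?U \<union> ?W \<notin> V // ?R - {?U, ?W}"
  proof
    assume "?U \<union> ?W \<in> V // ?R - {?U, ?W}"
    then have "?U \<union> ?W \<in> V // ?R" "?U \<union> ?W \<noteq> ?U" by blast+
    then obtain x where x: "?U \<union> ?W = ?R `` {x}" "?U \<union> ?W \<noteq> ?U"
      by (metis quotientE)
    have "u \<in> ?R `` {x}" unfolding x(1)[symmetric] by simp
    then have "(x, u) \<in> ?R" by simp
    from x(1) reach_image_eq[OF this] have "?U \<union> ?W = ?U" by (rule trans)
    with x(2) show False ..
  qed
  moreover have "finite (V // ?R)"
    using assms(1) by (simp add: quotient_def)
  moreover have "card {?U, ?W} = 2"
  proof -
    have "v \<in> ?W" "v \<notin> ?U" using assms(4) by simp_all
    then have "?U \<noteq> ?W" by metis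
    then show ?thesis by simp
  qed
  moreover have sub: "{?U, ?W} \<subseteq> V // ?R"
    using assms by (auto intro: quotientI)
  moreover have "card {?U, ?W} \<le> card (V // ?R)"
    using calculation by (intro card_mono)
  ultimately show ?thesis
    unfolding eq by (simp add: card_Diff_subset)
qed

lemma simple_graph_subset: "simple_graph V F \<Longrightarrow> F' \<subseteq> F \<Longrightarrow> simple_graph V F'"
  by (auto simp: simple_graph_def)

lemma simple_graph_finite_edges: "simple_graph V F \<Longrightarrow> finite F"
  unfolding simple_graph_def by (rule finite_subset[of _ "Pow V"]) auto

lemma grank_insert:
  assumes "finite V" "u \<in> V" "v \<in> V"
  shows "grank V (insert {u, v} F) = (if (u, v) \<in> reach F then grank V F else Suc (grank V F))"
proof (cases "(u, v) \<in> reach F")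
  case True
  then have "(x, y) \<in> reach (insert {u, v} F) \<longleftrightarrow> (x, y) \<in> reach F" for x y
    unfolding reach_insert using reach_sym reach_trans by metis
  then have "reach (insert {u, v} F) = reach F" by (intro set_eqI) (simp add: split_paired_all)
  with True show ?thesis by (simp add: grank_def)
next
  case False
  then show ?thesis
    using card_quotient_reach_insert[OF assms False] card_quotient_reach_le[OF assms(1), of F]
    by (simp add: grank_def)
qed

lemma grank_empty: "finite V \<Longrightarrow> grank V {} = 0"
  by (simp add: grank_def reach_def quotient_def card_image UNION_singleton_eq_range)

lemma simple_graph_edgeE:
  assumes "simple_graph V F" "e \<in> F"
  obtains u v where "e = {u, v}" "u \<in> V" "v \<in> V" "u \<noteq> v"
proof -
  have "card e = 2" "e \<subseteq> V" using assms by (auto simp: simple_graph_def)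
  then show ?thesis using that by (auto simp: card_2_iff)
qed

lemma simple_graph_edge_atE:
  assumes "simple_graph V F" "e \<in> F" "v \<in> e"
  obtains w where "e = {w, v}" "w \<in> V" "v \<in> V" "w \<noteq> v"
proof -
  obtain a b where "e = {a, b}" "a \<in> V" "b \<in> V" "a \<noteq> b"
    using assms(1,2) by (rule simple_graph_edgeE)
  with assms(3) that[of a] that[of b] show ?thesis by (auto simp: insert_commute)
qed

lemma grank_insert_bounds:
  assumes "simple_graph V F" "e \<in> F"
  shows "grank V G \<le> grank V (insert e G)" "grank V (insert e G) \<le> Suc (grank V G)"
proof -
  have "finite V" using assms(1) by (simp add: simple_graph_def)
  then show "grank V G \<le> grank V (insert e G)" "grank V (insert e G) \<le> Suc (grank V G)"
    using simple_graph_edgeE[OF assms] grank_insert by (metis le_Suc_eq order_refl)+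
qed

lemma grank_mono:
  assumes "simple_graph V F'" "F \<subseteq> F'"
  shows "grank V F \<le> grank V F'"
proof -
  have "grank V F \<le> grank V (F \<union> Z)" if "finite Z" "Z \<subseteq> F'" for Z
    using that
  proof (induction Z)
    case (insert e Z)
    then show ?case
      using grank_insert_bounds(1)[OF assms(1), of e "F \<union> Z"] by simp
  qed simp
  from this[OF simple_graph_finite_edges[OF assms(1)]] show ?thesis
    using assms(2) by (simp add: Un_absorb1)
qed

lemma grank_le_card:
  assumes "simple_graph V F"
  shows "grank V F \<le> card F"
proof -
  have "grank V Z \<le> card Z" if "finite Z" "Z \<subseteq> F" for Z
    using that
  proof (induction Z)
    case empty
    then show ?case using assms by (simp add: simple_graph_def grank_empty)
  next
    case (insert e Z)
    then show ?case
      using grank_insert_bounds(2)[OF assms, of e Z] by simp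
  qed
  with simple_graph_finite_edges[OF assms] show ?thesis by blast
qed

text \<open>Diminishing returns holds because vertices connected by a smaller edge set stay
  connected in a larger one: an edge adding no rank to \<open>F\<close> adds none to a superset
  \<open>G\<close>.\<close>

lemma grank_submodular:
  assumes "simple_graph V E" "X \<subseteq> E" "Y \<subseteq> E"
  shows "grank V (X \<union> Y) + grank V (X \<inter> Y) \<le> grank V X + grank V Y"
proof (rule submodular_if_diminishing_returns[where f = "grank V" and E = E])
  fix e F G assume FG: "F \<subseteq> G" "G \<subseteq> E" "e \<in> E"
  obtain u v where "e = {u, v}" "u \<in> V" "v \<in> V" "u \<noteq> v"
    using assms(1) FG(3) by (rule simple_graph_edgeE)
  moreover have "finite V" using assms(1) by (simp add: simple_graph_def)
  moreover have "(u, v) \<in> reach F \<Longrightarrow> (u, v) \<in> reach G"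
    using reach_mono[OF FG(1)] by (rule subsetD)
  ultimately show "grank V (insert e G) + grank V F \<le> grank V (insert e F) + grank V G"
    by (simp add: grank_insert)
qed (use assms simple_graph_finite_edges in auto)

text \<open>Build the star edge by edge. The outer end \<open>w\<close> of each new edge is still
  isolated, since the only star edge through \<open>w\<close> is the new one, so every insertion
  raises the rank.\<close>

lemma grank_star:
  assumes "simple_graph V F" "\<And>e. e \<in> F \<Longrightarrow> v \<in> e"
  shows "grank V F = card F"
proof -
  have "finite V" using assms(1) by (simp add: simple_graph_def)
  have "grank V Z = card Z" if "finite Z" "Z \<subseteq> F" for Z
    using that
  proof (induction Z)
    case empty
    then show ?case using \<open>finite V\<close> by (simp add: grank_empty)
  next
    case (insert e Z)
    then have "e \<in> F" by simp
    obtain w where w: "e = {w, v}" "w \<in> V" "v \<in> V" "w \<noteq> v"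
      using assms(1) \<open>e \<in> F\<close> assms(2)[OF \<open>e \<in> F\<close>] by (rule simple_graph_edge_atE)
    have "w \<notin> d" if "d \<in> Z" for d
    proof
      assume "w \<in> d"
      have "d \<in> F" using that insert.prems by blast
      obtain x where "d = {x, v}" "x \<in> V" "v \<in> V" "x \<noteq> v"
        using assms(1) \<open>d \<in> F\<close> assms(2)[OF \<open>d \<in> F\<close>] by (rule simple_graph_edge_atE)
      with \<open>w \<in> d\<close> w(4) have "d = {w, v}" by blast
      with that insert.hyps w show False by simp
    qed
    then have "(w, v) \<notin> reach Z" using reach_isolated w(4) by metis
    with insert w \<open>finite V\<close> show ?case by (simp add: grank_insert)
  qed
  with simple_graph_finite_edges[OF assms(1)] show ?thesis by blast
qed

text \<open>Delete all edges at a non-isolated vertex: they form a star, so there are at most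
  as many as the rank, and the rank drops because that vertex becomes isolated.\<close>

lemma card_edges_le_grank:
  assumes "simple_graph V F"
  shows "card F \<le> Suc (grank V F) choose 2"
  using assms
proof (induction "card F" arbitrary: F rule: less_induct)
  case less
  have fin: "finite V" "finite F"
    using less.prems simple_graph_finite_edges by (auto simp: simple_graph_def)
  show ?case
  proof (cases "F = {}")
    case False
    then obtain e where "e \<in> F" by blast
    then obtain u v where e: "e = {u, v}" "u \<in> V" "v \<in> V" "u \<noteq> v"
      using less.prems by (meson simple_graph_edgeE)
    define S where "S = {d \<in> F. u \<in> d}"
    have S: "S \<subseteq> F" "e \<in> S" using \<open>e \<in> F\<close> e by (auto simp: S_def)
    have "F - S \<subset> F" using S by blast
    then have lt: "card (F - S) < card F" using fin by (simp add: psubset_card_mono)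
    have sg: "simple_graph V S" "simple_graph V (F - S)" "simple_graph V (insert e (F - S))"
      using S by (auto intro: simple_graph_subset[OF less.prems])
    have "card S = grank V S"
      using grank_star[OF sg(1), of u] by (simp add: S_def)
    also have "\<dots> \<le> grank V F" using grank_mono[OF less.prems] S by blast
    finally have star: "card S \<le> grank V F" .
    have "u \<notin> d" if "d \<in> F - S" for d
      using that by (simp add: S_def)
    then have "(u, v) \<notin> reach (F - S)"
      using reach_isolated e(4) by metis
    then have "Suc (grank V (F - S)) = grank V (insert e (F - S))"
      using e fin by (simp add: grank_insert)
    also have "\<dots> \<le> grank V F"
      using S by (intro grank_mono[OF less.prems]) auto
    finally have "Suc (grank V (F - S)) \<le> grank V F" .
    then have "Suc (grank V (F - S)) choose 2 \<le> grank V F choose 2"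
      by (rule binomial_right_mono)
    then have "card (F - S) \<le> grank V F choose 2"
      using less.hyps[OF lt sg(2)] by linarith
    moreover have "card F = card S + card (F - S)"
      using fin S by (metis card_Diff_subset card_mono finite_subset le_add_diff_inverse)
    \<comment> \<open>Pascal's rule splits the bound into one part for the star and one for the
      remaining edges.\<close>
    moreover have "Suc (grank V F) choose 2 = grank V F + (grank V F choose 2)"
      by (simp add: numeral_2_eq_2)
    ultimately show ?thesis using star by simp
  qed simp
qed

section \<open>Spanning trees\<close>

lemma reach_imp_walk:
  assumes "(u, v) \<in> reach F" "simple_graph V F" "u \<in> V"
  shows "\<exists>p. walk V F p \<and> hd p = u \<and> last p = v"
  using assms(1) unfolding reach_def
proof (induction rule: rtrancl_induct)
  case base
  show ?case using assms(3) by (intro exI[of _ "[u]"]) (simp add: walk_def)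
next
  case (step y z)
  then obtain p where "walk V F p" "hd p = u" "last p = y" by blast
  moreover have "z \<in> V" using step.hyps assms(2) by (auto simp: simple_graph_def)
  ultimately show ?case using step.hyps
    by (intro exI[of _ "p @ [z]"]) (auto simp: walk_def successively_append_iff)
qed

lemma successively_imp_reach:
  "successively (\<lambda>u v. {u, v} \<in> F) p \<Longrightarrow> p \<noteq> [] \<Longrightarrow> (hd p, last p) \<in> reach F"
proof (induction p)
  case (Cons a p)
  then show ?case
    by (cases p) (auto intro: reach_trans[OF reach_edge])
qed simp

text \<open>Consecutive positions can carry the first and the last vertex of a distinct list only if
  its length is 2. Hence the ends of the closing edge of a cycle remain connected after that edge is
  deleted.\<close>

lemma successively_avoids_closing_edge:
  assumes "successively (\<lambda>u v. {u, v} \<in> F) p" "distinct p" "length p \<ge> 3"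
  shows "successively (\<lambda>u v. {u, v} \<in> F - {{last p, hd p}}) p"
  unfolding successively_conv_nth
proof (intro allI impI)
  fix i assume i: "Suc i < length p"
  have "{p ! i, p ! Suc i} \<in> F"
    using assms(1) i by (simp add: successively_conv_nth)
  moreover have "{p ! i, p ! Suc i} \<noteq> {last p, hd p}"
  proof
    assume eq: "{p ! i, p ! Suc i} = {last p, hd p}"
    have ne: "p \<noteq> []" using assms(3) by auto
    from eq have "p ! i = p ! 0 \<and> p ! Suc i = p ! (length p - 1) \<or>
        p ! i = p ! (length p - 1) \<and> p ! Suc i = p ! 0"
      by (auto simp: doubleton_eq_iff last_conv_nth hd_conv_nth ne)
    then show False
      using assms(3) i nth_eq_iff_index_eq[OF assms(2), of i 0]
        nth_eq_iff_index_eq[OF assms(2), of "Suc i" "length p - 1"]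
        nth_eq_iff_index_eq[OF assms(2), of "Suc i" 0] by linarith
  qed
  ultimately show "{p ! i, p ! Suc i} \<in> F - {{last p, hd p}}" by simp
qed

text \<open>The rank bound leaves at most one component, which gives connectedness. Deleting the
  closing edge of a cycle would keep the rank but lose an edge, so the rank would be below
  \<open>card T\<close>.\<close>

lemma tree_if_grank:
  assumes sg: "simple_graph V T" and V: "V \<noteq> {}"
    and card: "card T \<le> grank V T" and rank: "card V \<le> Suc (grank V T)"
  shows "tree V T"
proof -
  have fin: "finite V" "finite T"
    using sg simple_graph_finite_edges by (auto simp: simple_graph_def)
  have "card (V // reach T) \<le> 1"
    using rank card_quotient_reach_le[OF fin(1), of T] by (simp add: grank_def)
  moreover have "finite (V // reach T)"
    using fin by (simp add: quotient_def)
  ultimately have one: "\<forall>c \<in> V // reach T. \<forall>d \<in> V // reach T. c = d"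
    by (simp add: card_le_Suc0_iff_eq)
  have "(u, v) \<in> reach T" if "u \<in> V" "v \<in> V" for u v
  proof -
    have "reach T `` {u} = reach T `` {v}"
      using one quotientI[OF that(1)] quotientI[OF that(2)] by blast
    moreover have "v \<in> reach T `` {v}" by simp
    ultimately have "v \<in> reach T `` {u}" by (simp only:)
    then show ?thesis by simp
  qed
  then have "connected_graph V T"
    using reach_imp_walk[OF _ sg] V unfolding connected_graph_def by simp
  moreover have "\<not> cycle V T p" for p
  proof
    assume c: "cycle V T p"
    let ?e = "{last p, hd p}"
    have p: "p \<noteq> []" "set p \<subseteq> V" "?e \<in> T"
      using c by (auto simp: cycle_def walk_def)
    have "successively (\<lambda>u v. {u, v} \<in> T - {?e}) p"
      using c by (intro successively_avoids_closing_edge) (auto simp: cycle_def walk_def)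
    then have "(last p, hd p) \<in> reach (T - {?e})"
      using p(1) by (rule reach_sym[OF successively_imp_reach])
    moreover have ends: "last p \<in> V" "hd p \<in> V" using p by auto
    ultimately have "grank V (insert ?e (T - {?e})) = grank V (T - {?e})"
      unfolding grank_insert[OF fin(1) ends] by (intro if_P)
    then have "grank V T = grank V (T - {?e})"
      using p(3) by (simp add: insert_absorb)
    also have "\<dots> \<le> card (T - {?e})"
      by (intro grank_le_card simple_graph_subset[OF sg]) auto
    also have "\<dots> < card T"
      using p(3) fin by (intro psubset_card_mono) auto
    finally show False using card by simp
  qed
  ultimately show ?thesis using sg by (simp add: tree_def)
qed

section \<open>Sizes of unions of colour classes\<close>

text \<open>The extremal set is \<open>{1..card S}\<close>. In the induction the maximum
  \<open>b\<close> is at least the size of the set, because the set lies in \<open>{1..b}\<close>;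
  this is the increment in Pascal's rule.\<close>

lemma sum_ge_choose_2:
  fixes S :: "nat set"
  assumes "finite S" "0 \<notin> S"
  shows "Suc (card S) choose 2 \<le> \<Sum>S"
  using assms
proof (induction S rule: finite_linorder_max_induct)
  case (insert b S)
  have "insert b S \<subseteq> {1..b}"
  proof
    fix x assume x: "x \<in> insert b S"
    then have "x \<noteq> 0" using insert.prems by metis
    moreover have "x \<le> b" using x insert.hyps by (auto simp: less_imp_le)
    ultimately show "x \<in> {1..b}" by simp
  qed
  then have "card (insert b S) \<le> b"
    using card_mono[of "{1..b}"] by simp
  moreover have "b \<notin> S" using insert by blast
  ultimately show ?case
    using insert by (simp add: numeral_2_eq_2)
qed simp

text \<open>Let \<open>k\<close> be the size of \<open>N\<close>. If \<open>N\<close> fits into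
  \<open>{1..<n}\<close>, it consists of \<open>k\<close> distinct positive numbers, with sum at
  least \<open>(k choose 2) + k\<close>, and \<open>k\<close> is positive. Otherwise it is a 1
  together with \<open>k - 1\<close> distinct positive numbers, whose sum is at least
  \<open>k choose 2\<close>.\<close>

lemma sum_mset_ge_choose_2:
  assumes "N \<subseteq># add_mset 1 (mset_set {1..<n})" "N \<noteq> {#}"
  shows "1 + (size N choose 2) \<le> \<Sum>\<^sub># N"
proof -
  \<comment> \<open>A sub-multiset of a set has all multiplicities at most 1, hence is again a set,
    and \<open>sum_ge_choose_2\<close> applies to it.\<close>
  have S: "\<exists>S. finite S \<and> 0 \<notin> S \<and> M = mset_set S" if "M \<subseteq># mset_set {1..<n}" for M
  proof (intro exI conjI)
    have "count M x \<le> 1" for x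
      using mset_subset_eq_count[OF that, of x] by (simp add: count_mset_set' split: if_splits)
    then show "M = mset_set (set_mset M)"
      by (intro multiset_eqI) (metis count_greater_eq_one_iff count_mset_set(1,3) finite_set_mset
        le_antisym not_in_iff)
    show "0 \<notin> set_mset M" using set_mset_mono[OF that] by auto
  qed simp
  show ?thesis
  proof (cases "N \<subseteq># mset_set {1..<n}")
    case True
    then obtain S where S: "finite S" "0 \<notin> S" "N = mset_set S" using S by blast
    moreover have "card S > 0" using assms(2) S by (auto simp: card_gt_0_iff)
    ultimately show ?thesis
      using sum_ge_choose_2[of S] by (simp add: sum_unfold_sum_mset numeral_2_eq_2)
  next
    case False
    have "1 \<in># N"
    proof (rule ccontr)
      assume "1 \<notin># N"
      then have "N \<subseteq># mset_set {1..<n}"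
        using assms(1) by (metis insert_subset_eq_iff diff_single_trivial subset_eq_diff_conv
          add_mset_add_single)
      with False show False ..
    qed
    then obtain M where M: "N = add_mset 1 M" by (metis mset_add)
    with assms(1) obtain S where "finite S" "0 \<notin> S" "M = mset_set S" using S by auto
    with M show ?thesis
      using sum_ge_choose_2[of S] by (simp add: sum_unfold_sum_mset)
  qed
qed

text \<open>The sizes of the chosen classes form a sub-multiset of all class sizes, so classes of
  equal size are counted separately; disjointness turns the sum of sizes into the size of the
  union.\<close>

lemma cute_edge_colouring_card_Union:
  assumes "cute_edge_colouring n E C" "finite E" "J \<subseteq> C" "J \<noteq> {}"
  shows "1 + (card J choose 2) \<le> card (\<Union>J)"
proof -
  have part: "partition_on E C"
    using assms(1) by (simp add: cute_edge_colouring_def edge_colouring_def)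
  then have "finite C" using assms(2) by (simp add: finite_elements)
  then have "finite J" using assms(3) by (rule rev_finite_subset)
  have "image_mset card (mset_set J) \<subseteq># image_mset card (mset_set C)"
    using assms(3) \<open>finite C\<close> by (intro image_mset_subseteq_mono subset_imp_msubset_mset_set)
  then have "1 + (card J choose 2) \<le> (\<Sum>K\<in>J. card K)"
    using sum_mset_ge_choose_2[of "image_mset card (mset_set J)" n] assms \<open>finite J\<close>
    by (simp add: cute_edge_colouring_def sum_unfold_sum_mset mset_set_empty_iff)
  also have "\<dots> = card (\<Union>J)"
  proof (rule card_Union_disjoint[symmetric])
    show "pairwise disjnt J"
      using partition_onD2[OF part] assms(3)
      by (auto simp: disjoint_def pairwise_def disjnt_def)
    show "finite K" if "K \<in> J" for K
      using partition_onD1[OF part] that assms(2,3) by (metis Union_upper finite_subset subsetD)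
  qed
  finally show ?thesis .
qed

section \<open>A transversal of the colour classes that is a spanning tree\<close>

theorem theorem1:
  fixes n :: nat and V :: "'a set" and E :: "'a set set" and C :: "'a set set set"
  assumes "n \<ge> 1"
    and "simple_graph V E"
    and "card V = n + 1"
    and "card E = 1 + (n choose 2)"
    and "cute_edge_colouring n E C"
  shows "\<exists>T. spanning_tree V E T \<and> heterochromatic C T"
proof -
  have part: "partition_on E C" and "card C = n"
    using assms(5) by (simp_all add: cute_edge_colouring_def edge_colouring_def)
  have fin: "finite V" "finite E" "finite C"
    using assms(2) part simple_graph_finite_edges finite_elements
    by (auto simp: simple_graph_def)
  have sub: "K \<subseteq> E" if "K \<in> C" for K
    using partition_onD1[OF part] that by blast
  have rado: "card J \<le> grank V (\<Union>(id ` J))" if "J \<subseteq> C" for J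
  proof (cases "J = {}")
    case False
    have "simple_graph V (\<Union>J)"
      using sub that by (intro simple_graph_subset[OF assms(2)]) blast
    then have "1 + (card J choose 2) \<le> Suc (grank V (\<Union>J)) choose 2"
      using cute_edge_colouring_card_Union[OF assms(5) fin(2) that False] card_edges_le_grank
      by (meson le_trans)
    \<comment> \<open>Were the rank smaller than \<open>card J\<close>, monotonicity of binomials
      would bound the right-hand side by \<open>card J choose 2\<close>; the additional 1 on the
      left excludes this.\<close>
    then have "\<not> Suc (grank V (\<Union>J)) \<le> card J"
      using binomial_right_mono[of "Suc (grank V (\<Union>J))" "card J" 2] by linarith
    then show ?thesis by simp
  qed simp
  \<comment> \<open>The family of sets is \<open>C\<close> indexed by itself, hence
    \<open>id\<close>; \<open>t\<close> picks one edge from each colour class.\<close>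
  have "\<exists>t. (\<forall>K\<in>C. t K \<in> id K) \<and> card C \<le> grank V (t ` C)"
  proof (rule rado_submodular[where f = "grank V" and A = id and E = E])
    show "grank V X \<le> grank V Y" if "X \<subseteq> Y" "Y \<subseteq> E" for X Y
      using that grank_mono simple_graph_subset[OF assms(2)] by blast
  qed (use fin sub rado grank_empty grank_submodular[OF assms(2)] in auto)
  then obtain t where t: "\<And>K. K \<in> C \<Longrightarrow> t K \<in> K" "card C \<le> grank V (t ` C)"
    by auto
  have tE: "t ` C \<subseteq> E" using t(1) sub by blast
  have "tree V (t ` C)"
  proof (rule tree_if_grank)
    show "simple_graph V (t ` C)" using tE by (rule simple_graph_subset[OF assms(2)])
    show "V \<noteq> {}" using assms(3) by auto
    show "card (t ` C) \<le> grank V (t ` C)"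
      using t(2) card_image_le[OF fin(3), of t] by linarith
    \<comment> \<open>There are \<open>n\<close> colours and \<open>n + 1\<close> vertices, so rank
      at least \<open>n\<close> is full rank.\<close>
    show "card V \<le> Suc (grank V (t ` C))"
      using t(2) assms(3) \<open>card C = n\<close> by simp
  qed
  moreover have "heterochromatic C (t ` C)"
  proof -
    \<comment> \<open>By disjointness the only class containing \<open>t K\<close> is
      \<open>K\<close>, so chosen edges that share a class coincide.\<close>
    have "K = L" if "K \<in> C" "L \<in> C" "t K \<in> L" for K L
      using partition_onD2[OF part] t(1)[OF that(1)] that by (auto simp: disjoint_def)
    then show ?thesis unfolding heterochromatic_def by blast
  qed
  ultimately show ?thesis using tE by (auto simp: spanning_tree_def)
qed

end
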